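(* Let $q$ be a prime power, $k\ge1$, $n=2k$, $V=\mathbb{F}_q^n$. Then $1/Z_c(X_0^{[k]}(V),u)$ is a product of factors of the form $(1\pm q^su)$ with $s\in\mathbb{Z}_{\ge0}$.
   Context: $X_0(V)$ is the undirected graph (viewed as a digraph with edges in both directions) whose vertices $x_W$ are the nonzero proper subspaces $W$ of $V$, with an edge between $x_{W_1}$ and $x_{W_2}$ iff $W_1\oplus W_2=V$. $X_0^{[k]}(V)$ is the induced subgraph on the vertices $x_W$ with $\dim W=k$. For a finite digraph $X$, $N_c(X,l)$ is the number of closed walks of length $l$ and $Z_c(X,u)=\exp\left(\sum_{l\ge1}\frac{N_c(X,l)}{l}u^l\right)$. *)

theory Defs
  imports
    "HOL-Analysis.Analysis"
    "HOL-Computational_Algebra.Computational_Algebra"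
    "Graph_Theory.Graph_Theory"
begin

text \<open>
  A closed walk is a pair of a base point \<open>u\<close> and a list of arcs leading from \<open>u\<close> to \<open>u\<close>;
  rotations of a closed walk are counted separately.
\<close>

definition num_closed_walks :: "('v, 'e) pre_digraph \<Rightarrow> nat \<Rightarrow> nat" where
  "num_closed_walks X l = card {(u, p). pre_digraph.awalk X u p u \<and> length p = l}"

definition walk_zeta :: "('v, 'e) pre_digraph \<Rightarrow> rat fps" where
  "walk_zeta X =
     fps_exp 1 oo Abs_fps (\<lambda>l. if l = 0 then 0 else of_nat (num_closed_walks X l) / of_nat l)"

definition is_direct_sum ::
  "('a::field ^ 'n) set \<Rightarrow> ('a ^ 'n) set \<Rightarrow> ('a ^ 'n) set \<Rightarrow> bool" where
  "is_direct_sum V W1 W2 \<longleftrightarrow> W1 \<inter> W2 = {0} \<and> {x + y | x y. x \<in> W1 \<and> y \<in> W2} = V"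

definition X0_verts :: "('a::field ^ 'n::finite) set \<Rightarrow> ('a ^ 'n) set set" where
  "X0_verts V = {W. vec.subspace W \<and> W \<noteq> {0} \<and> W \<subset> V}"

text \<open>Here \<open>V\<close> is meant to be a subspace of the ambient space, possibly the whole of it.\<close>

definition X0 ::
  "('a::field ^ 'n::finite) set \<Rightarrow> (('a ^ 'n) set, ('a ^ 'n) set \<times> ('a ^ 'n) set) pre_digraph"
where
  "X0 V = \<lparr> verts = X0_verts V,
            arcs = {(W1, W2) \<in> X0_verts V \<times> X0_verts V. is_direct_sum V W1 W2},
            tail = fst, head = snd \<rparr>"

definition X0_dim ::
  "nat \<Rightarrow> ('a::field ^ 'n::finite) set
    \<Rightarrow> (('a ^ 'n) set, ('a ^ 'n) set \<times> ('a ^ 'n) set) pre_digraph"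
where
  "X0_dim k V = induce_subgraph (X0 V) {W \<in> verts (X0 V). vec.dim W = k}"

lemma is_direct_sum_commute: "is_direct_sum V W1 W2 \<longleftrightarrow> is_direct_sum V W2 W1"
proof -
  have "{x + y | x y. x \<in> W1 \<and> y \<in> W2} = {x + y | x y. x \<in> W2 \<and> y \<in> W1}"
    by (metis (no_types, opaque_lifting) add.commute)
  then show ?thesis
    by (simp add: is_direct_sum_def Int_commute)
qed

lemma X0_graph:
  fixes V :: "('a::{field,finite} ^ 'n) set"
  shows "graph (X0 V)"
proof
  show "symmetric (X0 V)"
    unfolding symmetric_conv by (auto simp: X0_def is_direct_sum_commute[of V])
next
  fix e assume "e \<in> arcs (X0 V)"
  then show "tail (X0 V) e \<noteq> head (X0 V) e"
    by (auto simp: X0_def X0_verts_def is_direct_sum_def)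
qed (auto simp: X0_def arc_to_ends_def prod_eq_iff)

lemma X0_dim_graph:
  fixes V :: "('a::{field,finite} ^ 'n) set"
  shows "graph (X0_dim k V)"
proof -
  interpret graph "X0 V" by (rule X0_graph)
  have "induced_subgraph (X0_dim k V) (X0 V)"
    unfolding X0_dim_def by (rule induced_induce) auto
  then show ?thesis
    by (intro graph.intro pseudo_graph.intro digraphI_induced induced_graph_imp_graph
        digraph.axioms(1)[OF digraphI_induced])
qed

end

(* The number of closed walks of length l is the trace of the l-th power of the adjacency matrix, so
   the reciprocal of the zeta function is the product of 1 - e u over the complex eigenvalues e with
   multiplicity, and it suffices to see that each eigenvalue is a power of q up to sign.

   Let f be an eigenfunction for e, let F(T) be the sum of f over the vertices containing T, and pick
   a minimal subspace S with F(S) nonzero. The number of complements of U containing S is a constant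
   power of q if U meets S trivially, and 0 otherwise; hence e F(S) is that power of q times the sum
   of f over the U with U \<inter> S = 0. Building S up one basis vector at a time (in place of Moebius
   inversion), and using that F vanishes below S, this last sum is a power of q, up to sign,
   times F(S). *)
theory Submission
  imports Defs "Jordan_Normal_Form.Schur_Decomposition"
begin

section \<open>The zeta function when closed walk counts are power sums\<close>

text \<open>Logarithmic differentiation: with power sums as walk counts, the zeta function and the
  product on the right have opposite logarithmic derivatives. Their product is therefore constant,
  equal to its constant term 1.\<close>

lemma inverse_walk_zeta:
  fixes X :: "('v, 'e) pre_digraph" and ls :: "rat list"
  assumes "\<And>l. of_nat (num_closed_walks X l) = (\<Sum>e\<leftarrow>ls. e ^ l)"
  shows "1 / walk_zeta X = (\<Prod>e\<leftarrow>ls. 1 - fps_const e * fps_X)"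
proof -
  define a where "a = Abs_fps (\<lambda>l. if l = 0 then 0 else of_nat (num_closed_walks X l) / of_nat l :: rat)"
  define P where "P = (\<lambda>ls. \<Prod>e\<leftarrow>ls. 1 - fps_const e * fps_X :: rat fps)"
  \<comment> \<open>This is the expansion of \<open>e / (1 - e X)\<close>, minus the logarithmic
    derivative of \<open>1 - e X\<close>.\<close>
  define G where "G e = Abs_fps (\<lambda>l. e ^ Suc l)" for e :: rat
  have geo: "(1 - fps_const e * fps_X) * G e = fps_const e" for e
  proof (rule fps_ext)
    fix n
    have "((1 - fps_const e * fps_X) * G e) $ n = G e $ n - e * (fps_X * G e) $ n"
      by (simp add: left_diff_distrib mult.assoc)
    then show "((1 - fps_const e * fps_X) * G e) $ n = fps_const e $ n"
      by (cases n) (simp_all add: G_def)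
  qed
  \<comment> \<open>Differentiation cancels the denominators \<open>l\<close> and shifts the index,
    hence the exponent \<open>Suc l\<close> in \<open>G\<close>.\<close>
  have deriv_a: "fps_deriv a = (\<Sum>e\<leftarrow>ls. G e)"
  proof (rule fps_ext)
    fix l
    have "(\<Sum>e\<leftarrow>ls. G e) $ l = (\<Sum>e\<leftarrow>ls. e ^ Suc l)"
      by (induction ls) (simp_all add: G_def)
    then show "fps_deriv a $ l = (\<Sum>e\<leftarrow>ls. G e) $ l"
      by (simp add: a_def assms del: of_nat_Suc)
  qed
  have deriv_P: "fps_deriv (P ls) = - P ls * (\<Sum>e\<leftarrow>ls. G e)" for ls
  proof (induction ls)
    case (Cons e ls)
    have "fps_deriv (P (e # ls)) =
        (1 - fps_const e * fps_X) * (- P ls * (\<Sum>e\<leftarrow>ls. G e)) - fps_const e * P ls"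
      using Cons by (simp add: P_def flip: fps_const_neg)
    also have "fps_const e * P ls = (1 - fps_const e * fps_X) * G e * P ls"
      by (simp only: geo)
    also have "(1 - fps_const e * fps_X) * (- P ls * (\<Sum>e\<leftarrow>ls. G e)) - \<dots> =
        - P (e # ls) * (\<Sum>e\<leftarrow>e # ls. G e)"
      by (simp add: P_def algebra_simps)
    finally show ?case .
  qed (simp add: P_def)
  have a0: "a $ 0 = 0" by (simp add: a_def)
  have E: "walk_zeta X = fps_exp 1 oo a" by (simp add: walk_zeta_def a_def)
  have "fps_deriv (fps_exp 1 oo a) = (fps_exp 1 oo a) * fps_deriv a"
    by (simp add: fps_compose_deriv[OF a0])
  then have "fps_deriv (walk_zeta X * P ls) = 0"
    by (simp add: E deriv_P deriv_a algebra_simps)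
  then have "walk_zeta X * P ls = fps_const ((walk_zeta X * P ls) $ 0)"
    by (simp only: fps_deriv_eq_0_iff)
  moreover have "P ls $ 0 = 1"
    unfolding P_def by (induction ls) simp_all
  ultimately have "walk_zeta X * P ls = 1"
    by (simp add: E)
  \<comment> \<open>A nonzero constant term makes the series a unit, so the division is
    multiplication by its inverse.\<close>
  moreover have "walk_zeta X $ 0 \<noteq> 0" by (simp add: E)
  ultimately show ?thesis
    by (simp add: fps_divide_unit fps_inverse_unique P_def)
qed

section \<open>Traces of matrix powers and eigenvalues\<close>

lemma upper_triangular_mult:
  fixes A B :: "'a::comm_semiring_1 mat"
  assumes A: "A \<in> carrier_mat n n" "upper_triangular A"
    and B: "B \<in> carrier_mat n n" "upper_triangular B"
  shows "upper_triangular (A * B)" and "i < n \<Longrightarrow> (A * B) $$ (i, i) = A $$ (i, i) * B $$ (i, i)"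
proof -
  have eq: "(A * B) $$ (i, j) = (\<Sum>k = 0..<n. A $$ (i, k) * B $$ (k, j))"
    if "i < n" "j < n" for i j
    using that A(1) B(1) by (simp add: scalar_prod_def)
  show "upper_triangular (A * B)"
  proof (rule upper_triangularI)
    fix i j assume ij: "j < i" "i < dim_row (A * B)"
    \<comment> \<open>Either \<open>k < i\<close> and the entry of \<open>A\<close> lies below the
      diagonal, or \<open>j < i \<le> k\<close> and the entry of \<open>B\<close> does.\<close>
    have "A $$ (i, k) * B $$ (k, j) = 0" if "k < n" for k
    proof (cases "k < i")
      case True
      then show ?thesis using upper_triangularD[OF A(2) True] ij A(1) by simp
    next
      case False
      then show ?thesis using upper_triangularD[OF B(2), of j k] ij that B(1) by simp
    qed
    then show "(A * B) $$ (i, j) = 0" using ij A(1) by (simp add: eq)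
  qed
  assume i: "i < n"
  have "A $$ (i, k) * B $$ (k, i) = 0" if "k < n" "k \<noteq> i" for k
  proof (cases "k < i")
    case True
    then show ?thesis using upper_triangularD[OF A(2) True] i A(1) by simp
  next
    case False
    then show ?thesis using upper_triangularD[OF B(2), of i k] that B(1) by simp
  qed
  then have "(\<Sum>k = 0..<n. A $$ (i, k) * B $$ (k, i)) = (\<Sum>k\<in>{i}. A $$ (i, k) * B $$ (k, i))"
    using i by (intro sum.mono_neutral_right) auto
  with i show "(A * B) $$ (i, i) = A $$ (i, i) * B $$ (i, i)" by (simp add: eq)
qed

lemma upper_triangular_pow:
  fixes A :: "'a::comm_semiring_1 mat"
  assumes "A \<in> carrier_mat n n" "upper_triangular A"
  shows "upper_triangular (A ^\<^sub>m l) \<and> (\<forall>i<n. (A ^\<^sub>m l) $$ (i, i) = A $$ (i, i) ^ l)"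
proof (induction l)
  case 0
  then show ?case using assms by (auto intro!: upper_triangularI)
next
  case (Suc l)
  then show ?case
    using upper_triangular_mult[of "A ^\<^sub>m l" n A] assms by (simp add: mult.commute)
qed

lemma sum_diag_mult_commute:
  fixes A B :: "'a::comm_semiring_1 mat"
  assumes "A \<in> carrier_mat n n" "B \<in> carrier_mat n n"
  shows "(\<Sum>i<n. (A * B) $$ (i, i)) = (\<Sum>i<n. (B * A) $$ (i, i))"
proof -
  have "(\<Sum>i<n. (A * B) $$ (i, i)) = (\<Sum>i<n. \<Sum>k<n. A $$ (i, k) * B $$ (k, i))"
    using assms by (simp add: scalar_prod_def atLeast0LessThan)
  also have "\<dots> = (\<Sum>k<n. \<Sum>i<n. A $$ (i, k) * B $$ (k, i))" by (rule sum.swap)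
  also have "\<dots> = (\<Sum>i<n. (B * A) $$ (i, i))"
    using assms by (simp add: scalar_prod_def atLeast0LessThan mult.commute)
  finally show ?thesis .
qed

text \<open>The Schur decomposition yields a triangular \<open>B\<close> similar to \<open>A\<close>
  whose diagonal lists the roots of the characteristic polynomial with multiplicity. Powers of
  \<open>B\<close> have the powers of these roots on the diagonal, and similarity preserves the
  trace.\<close>

lemma trace_pow_eq_sum_eigenvalues:
  fixes A :: "complex mat"
  assumes A: "A \<in> carrier_mat n n"
  obtains es where "\<And>e. e \<in> set es \<Longrightarrow> eigenvalue A e"
    and "\<And>l. (\<Sum>i<n. (A ^\<^sub>m l) $$ (i, i)) = (\<Sum>e\<leftarrow>es. e ^ l)"
proof -
  from char_poly_factorized[OF A] obtain es
    where cp: "char_poly A = (\<Prod>e\<leftarrow>es. [:- e, 1:])" by blast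
  obtain B P Q where "schur_decomposition A es = (B, P, Q)" by (metis prod_cases3)
  from schur_decomposition[OF A cp this]
  have wit: "similar_mat_wit A B P Q" and tri: "upper_triangular B" and diag: "diag_mat B = es"
    by auto
  note sim = similar_mat_witD2[OF A wit]
  have "eigenvalue A e" if "e \<in> set es" for e
    using that by (simp add: eigenvalue_root_char_poly[OF A] cp poly_prod_list prod_list_zero_iff)
  moreover have "(\<Sum>i<n. (A ^\<^sub>m l) $$ (i, i)) = (\<Sum>e\<leftarrow>es. e ^ l)" for l
  proof -
    have B: "B ^\<^sub>m l \<in> carrier_mat n n" using sim by simp
    have "(\<Sum>i<n. (A ^\<^sub>m l) $$ (i, i)) = (\<Sum>i<n. (P * (B ^\<^sub>m l * Q)) $$ (i, i))"
      unfolding similar_mat_wit_pow_id[OF wit, of l] using assoc_mult_mat[OF sim(6) B sim(7)] by simp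
    \<comment> \<open>Moving \<open>P\<close> to the right end brings it next to \<open>Q\<close>,
      where \<open>Q * P = 1\<close> cancels.\<close>
    also have "\<dots> = (\<Sum>i<n. ((B ^\<^sub>m l * Q) * P) $$ (i, i))"
      using sim(6,7) B by (intro sum_diag_mult_commute) simp_all
    also have "(B ^\<^sub>m l * Q) * P = B ^\<^sub>m l"
      using assoc_mult_mat[OF B sim(7,6)] by (simp only: sim(2) right_mult_one_mat[OF B])
    also have "(\<Sum>i<n. (B ^\<^sub>m l) $$ (i, i)) = (\<Sum>i<n. B $$ (i, i) ^ l)"
      using upper_triangular_pow[OF _ tri] sim by simp
    also have "\<dots> = (\<Sum>e\<leftarrow>es. e ^ l)"
      using sim unfolding diag[symmetric] diag_mat_def
      by (simp add: interv_sum_list_conv_sum_set_nat atLeast0LessThan comp_def)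
    finally show ?thesis .
  qed
  ultimately show thesis by (rule that)
qed

section \<open>Closed walks and eigenfunctions of a finite digraph\<close>

text \<open>Entries of powers of the adjacency matrix count walks, so traces count closed walks.
  Eigenvectors are restated as functions on vertices, which confines the matrix and the enumeration
  of vertices to this proof.\<close>

lemma (in fin_digraph) num_closed_walks_eq_sum_eigenvalues:
  obtains es :: "complex list"
  where "\<And>e. e \<in> set es \<Longrightarrow> \<exists>\<phi>. (\<exists>v\<in>verts G. \<phi> v \<noteq> 0) \<and>
      (\<forall>v\<in>verts G. (\<Sum>a\<in>out_arcs G v. \<phi> (head G a)) = e * \<phi> v)"
    and "\<And>l. of_nat (num_closed_walks G l) = (\<Sum>e\<leftarrow>es. e ^ l)"
proof -
  define n where "n = card (verts G)"
  obtain f where f: "bij_betw f {..<n} (verts G)"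
    using ex_bij_betw_nat_finite[OF finite_verts] by (auto simp: n_def atLeast0LessThan)
  \<comment> \<open>A general digraph may have parallel arcs, so the matrix entries are numbers of
    arcs rather than 0 or 1.\<close>
  define arcs_btw where "arcs_btw u v = {a \<in> arcs G. tail G a = u \<and> head G a = v}" for u v
  define walks where "walks l u v = {p. awalk u p v \<and> length p = l}" for l u v
  define A :: "complex mat" where "A = mat n n (\<lambda>(i, j). of_nat (card (arcs_btw (f i) (f j))))"
  have A: "A \<in> carrier_mat n n" by (simp add: A_def)
  have f_verts: "f i \<in> verts G" if "i < n" for i
    using f that by (auto simp: bij_betw_def)
  have sum_verts: "(\<Sum>i<n. g (f i)) = (\<Sum>v\<in>verts G. g v)" for g :: "'a \<Rightarrow> 'c::comm_monoid_add"
    by (rule sum.reindex_bij_betw[OF f])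
  have fin_btw: "finite (arcs_btw u v)" for u v by (simp add: arcs_btw_def)
  have fin_walks: "finite (walks l u v)" for l u v
  proof (rule finite_subset)
    show "walks l u v \<subseteq> {p. set p \<subseteq> arcs G \<and> length p = l}"
      by (auto simp: walks_def awalk_def)
  qed (simp add: finite_lists_length_eq)
  have card_walks_Suc: "card (walks (Suc l) u v) = (\<Sum>w\<in>verts G. card (walks l u w) * card (arcs_btw w v))"
    if "u \<in> verts G" for l u v
  proof -
    \<comment> \<open>A nonempty walk is split at its last arc \<open>a\<close>; the intermediate
      vertex \<open>w\<close> is the tail of \<open>a\<close>.\<close>
    have "walks (Suc l) u v = (\<Union>w\<in>verts G. (\<lambda>(p, a). p @ [a]) ` (walks l u w \<times> arcs_btw w v))"
      (is "?l = ?r")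
    proof (intro equalityI subsetI)
      fix p assume p: "p \<in> ?l"
      then have "p \<noteq> []" by (auto simp: walks_def)
      then obtain p' a where pa: "p = p' @ [a]" by (metis rev_exhaust)
      with p have "awalk u p' (tail G a)" "a \<in> arcs G" "head G a = v" "length p' = l"
        by (auto simp: walks_def awalk_Cons_iff awalk_Nil_iff awalk_append_iff)
      then show "p \<in> ?r" by (auto simp: pa walks_def arcs_btw_def intro!: bexI[of _ "tail G a"])
    next
      fix p assume "p \<in> ?r"
      then show "p \<in> ?l"
        by (auto simp: walks_def arcs_btw_def awalk_append_iff awalk_Cons_iff awalk_Nil_iff)
    qed
    moreover have "inj_on (\<lambda>(p, a). p @ [a]) Y" for Y :: "('b list \<times> 'b) set"
      by (auto simp: inj_on_def)
    moreover have "card (\<Union>w\<in>verts G. (\<lambda>(p, a). p @ [a]) ` (walks l u w \<times> arcs_btw w v))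
      = (\<Sum>w\<in>verts G. card ((\<lambda>(p, a). p @ [a]) ` (walks l u w \<times> arcs_btw w v)))"
      by (rule card_UN_disjoint) (use fin_walks fin_btw in \<open>auto simp: arcs_btw_def\<close>)
    ultimately show ?thesis by (simp add: card_image card_cartesian_product)
  qed
  have pow: "(A ^\<^sub>m l) $$ (i, j) = of_nat (card (walks l (f i) (f j)))" if "i < n" "j < n" for i j l
    using that
  proof (induction l arbitrary: j)
    case 0
    have "walks 0 (f i) (f j) = (if i = j then {[]} else {})"
      using f 0 f_verts by (auto simp: walks_def awalk_Nil_iff bij_betw_def inj_on_def)
    then show ?case using 0 A by simp
  next
    case (Suc l)
    have "(A ^\<^sub>m Suc l) $$ (i, j) = (\<Sum>m<n. (A ^\<^sub>m l) $$ (i, m) * A $$ (m, j))"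
      using Suc.prems A pow_carrier_mat[OF A, of l]
      by (simp add: scalar_prod_def atLeast0LessThan)
    also have "\<dots> = (\<Sum>m<n. of_nat (card (walks l (f i) (f m)) * card (arcs_btw (f m) (f j))))"
      using Suc by (intro sum.cong) (auto simp: A_def)
    also have "\<dots> = of_nat (card (walks (Suc l) (f i) (f j)))"
      using sum_verts[of "\<lambda>w. of_nat (card (walks l (f i) w) * card (arcs_btw w (f j)))"]
        card_walks_Suc[OF f_verts[OF Suc.prems(1)]] by simp
    finally show ?case .
  qed
  have trace: "(\<Sum>i<n. (A ^\<^sub>m l) $$ (i, i)) = of_nat (num_closed_walks G l)" for l
  proof -
    have "{(u, p). awalk u p u \<and> length p = l} = (SIGMA u:verts G. walks l u u)"
      by (auto simp: walks_def)
    then have "num_closed_walks G l = (\<Sum>u\<in>verts G. card (walks l u u))"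
      using fin_walks by (simp add: num_closed_walks_def)
    then show ?thesis
      using sum_verts[of "\<lambda>u. of_nat (card (walks l u u))"] by (simp add: pow)
  qed
  obtain es where eig: "\<And>e. e \<in> set es \<Longrightarrow> eigenvalue A e"
    and es: "\<And>l. (\<Sum>i<n. (A ^\<^sub>m l) $$ (i, i)) = (\<Sum>e\<leftarrow>es. e ^ l)"
    using trace_pow_eq_sum_eigenvalues[OF A] by blast
  have "\<exists>\<phi>. (\<exists>v\<in>verts G. \<phi> v \<noteq> 0) \<and>
      (\<forall>v\<in>verts G. (\<Sum>a\<in>out_arcs G v. \<phi> (head G a)) = e * \<phi> v)" if "e \<in> set es" for e
  proof -
    from eig[OF that] obtain x where x: "x \<in> carrier_vec n" "x \<noteq> 0\<^sub>v n" "A *\<^sub>v x = e \<cdot>\<^sub>v x"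
      using A by (auto simp: eigenvalue_def eigenvector_def)
    define \<phi> where "\<phi> v = x $ (inv_into {..<n} f v)" for v
    have \<phi>: "\<phi> (f i) = x $ i" if "i < n" for i
      using f that by (simp add: \<phi>_def bij_betw_def)
    have "\<exists>i<n. x $ i \<noteq> 0" using x(1,2) by (metis eq_vecI carrier_vecD index_zero_vec)
    then have "\<exists>v\<in>verts G. \<phi> v \<noteq> 0" using \<phi> f_verts by metis
    moreover have "(\<Sum>a\<in>out_arcs G v. \<phi> (head G a)) = e * \<phi> v" if "v \<in> verts G" for v
    proof -
      from that f obtain i where i: "i < n" "v = f i" by (auto simp: bij_betw_def)
      \<comment> \<open>Grouping the outgoing arcs by their heads turns the sum into an entry of
        \<open>A *\<^sub>v x\<close>.\<close>
      have "(\<Sum>a\<in>out_arcs G v. \<phi> (head G a))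
          = (\<Sum>w\<in>verts G. \<Sum>a | a \<in> out_arcs G v \<and> head G a = w. \<phi> (head G a))"
        by (rule sum.group[symmetric]) auto
      also have "\<dots> = (\<Sum>w\<in>verts G. of_nat (card (arcs_btw v w)) * \<phi> w)"
        by (intro sum.cong) (auto simp: arcs_btw_def out_arcs_def conj_ac)
      also have "\<dots> = (\<Sum>j<n. A $$ (i, j) * x $ j)"
        using i by (simp add: sum_verts[symmetric] \<phi> A_def)
      also have "\<dots> = (A *\<^sub>v x) $ i"
        using A x(1) i by (simp add: scalar_prod_def atLeast0LessThan)
      also have "\<dots> = e * \<phi> v" using x i \<phi> by simp
      finally show ?thesis .
    qed
    ultimately show ?thesis by blast
  qed
  with es trace show thesis by (intro that[of es]) auto
qed


section \<open>Counting vectors and complements over a finite field\<close>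

lemma Int_eq_zeroD: "A \<inter> B = {0} \<Longrightarrow> x \<in> A \<Longrightarrow> x \<in> B \<Longrightarrow> x = 0"
  by blast

lemma vec_span_scaleD:
  fixes x :: "'a::field ^ 'n"
  assumes "c *s x \<in> vec.span B" "x \<notin> vec.span B"
  shows "c = 0"
  using assms vec.span_scale[of "c *s x" B "inverse c"]
  by (cases "c = 0") (simp_all add: vector_smult_assoc)

lemma card_vec_span:
  fixes B :: "('a::{field,finite} ^ 'n) set"
  assumes "vec.independent B"
  shows "card (vec.span B) = CARD('a) ^ card B"
proof -
  have "finite B" by simp
  then show ?thesis using assms
  proof (induction B rule: finite_induct)
    case empty
    then show ?case by simp
  next
    case (insert b B)
    have b: "b \<notin> vec.span B" and indep: "vec.independent B"
      using insert.prems insert.hyps by (simp_all add: vec.independent_insert)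
    \<comment> \<open>Each vector of the larger span has a unique coefficient at \<open>b\<close>,
      so every new basis vector multiplies the cardinality by that of the field.\<close>
    have "bij_betw (\<lambda>(c, x). c *s b + x) (UNIV \<times> vec.span B) (vec.span (insert b B))"
    proof (rule bij_betwI')
      fix p p' :: "'a \<times> ('a ^ 'n)"
      assume p: "p \<in> UNIV \<times> vec.span B" and p': "p' \<in> UNIV \<times> vec.span B"
      obtain c x c' x' where eq: "p = (c, x)" "p' = (c', x')" by fastforce
      show "(case p of (c, x) \<Rightarrow> c *s b + x) = (case p' of (c, x) \<Rightarrow> c *s b + x) \<longleftrightarrow> p = p'"
      proof
        assume "(case p of (c, x) \<Rightarrow> c *s b + x) = (case p' of (c, x) \<Rightarrow> c *s b + x)"
        then have diff: "(c - c') *s b = x' - x"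
          by (simp add: eq algebra_simps vec.scale_left_diff_distrib)
        moreover have "x' - x \<in> vec.span B"
          using p p' eq by (simp add: vec.span_diff)
        ultimately have "(c - c') *s b \<in> vec.span B" by simp
        then have "c - c' = 0" using b by (rule vec_span_scaleD)
        then have "c = c'" by simp
        with diff show "p = p'" by (simp add: eq)
      qed simp
    next
      fix p :: "'a \<times> ('a ^ 'n)"
      assume "p \<in> UNIV \<times> vec.span B"
      then show "(case p of (c, x) \<Rightarrow> c *s b + x) \<in> vec.span (insert b B)"
        using vec.span_mono[OF subset_insertI[of B b]]
        by (auto intro!: vec.span_add[OF vec.span_scale[OF vec.span_base]])
    next
      fix y assume "y \<in> vec.span (insert b B)"
      then obtain c where "y - c *s b \<in> vec.span B"
        by (auto simp: vec.span_insert)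
      then show "\<exists>p\<in>UNIV \<times> vec.span B. y = (case p of (c, x) \<Rightarrow> c *s b + x)"
        by (intro bexI[of _ "(c, y - c *s b)"]) simp_all
    qed
    then have "card (vec.span (insert b B)) = CARD('a) * card (vec.span B)"
      by (metis bij_betw_same_card card_cartesian_product)
    with insert.IH[OF indep] insert.hyps show ?case by simp
  qed
qed

lemma card_vec_subspace:
  fixes W :: "('a::{field,finite} ^ 'n) set"
  assumes "vec.subspace W"
  shows "card W = CARD('a) ^ vec.dim W"
proof -
  obtain B where "B \<subseteq> W" "vec.independent B" "W \<subseteq> vec.span B" "card B = vec.dim W"
    using vec.basis_exists[of W] by blast
  then show ?thesis
    using card_vec_span[of B] vec.span_subspace[OF _ _ assms] by metis
qed

lemma vec_sums_eq_UNIV: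
  fixes U W :: "('a::field ^ 'n) set"
  assumes "vec.subspace U" "vec.subspace W" "U \<inter> W = {0}" "vec.dim U + vec.dim W = CARD('n)"
  shows "{x + y |x y. x \<in> U \<and> y \<in> W} = UNIV"
proof -
  have "vec.dim {x + y |x y. x \<in> U \<and> y \<in> W} = CARD('n)"
    using vec.dim_sums_Int[OF assms(1,2)] assms(3,4) by simp
  then show ?thesis
    using vec.subspace_dim_equal[OF vec.subspace_sums[OF assms(1,2)] vec.subspace_UNIV]
    by (simp only: vec_dim_card order_refl subset_UNIV)
qed

text \<open>Induction on \<open>k - vec.dim S\<close>. Below dimension \<open>k\<close>, the
  complements of \<open>W\<close> containing \<open>S\<close> are sorted by which of the
  \<open>card W\<close> enlargements of \<open>S\<close> by one dimension they contain. Each round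
  contributes a factor \<open>CARD('a) ^ vec.dim W\<close>, and there are
  \<open>k - vec.dim S\<close> rounds.\<close>

lemma card_complements_containing:
  fixes S W :: "('a::{field,finite} ^ 'n) set"
  assumes "vec.subspace S" "vec.subspace W" "S \<inter> W = {0}"
    and "vec.dim W + k = CARD('n)"
  shows "card {U. vec.subspace U \<and> vec.dim U = k \<and> S \<subseteq> U \<and> U \<inter> W = {0}}
    = CARD('a) ^ (vec.dim W * (k - vec.dim S))"
  using assms(1,3)
proof (induction "k - vec.dim S" arbitrary: S rule: less_induct)
  case (less S)
  let ?\<C> = "\<lambda>S. {U. vec.subspace U \<and> vec.dim U = k \<and> S \<subseteq> U \<and> U \<inter> W = {0}}"
  have dim_sum: "vec.dim {x + y |x y. x \<in> S \<and> y \<in> W} = vec.dim S + vec.dim W"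
    using vec.dim_sums_Int[OF less.prems(1) assms(2)] less.prems(2) by simp
  then have "vec.dim S + vec.dim W \<le> CARD('n)"
    using vec.dim_subset[OF subset_UNIV, of "{x + y |x y. x \<in> S \<and> y \<in> W}"]
    by (simp only: vec_dim_card)
  then have le: "vec.dim S \<le> k" using assms(4) by simp
  show ?case
  proof (cases "vec.dim S = k")
    case True
    have "U \<in> ?\<C> S \<longleftrightarrow> U = S" for U
    proof
      assume "U \<in> ?\<C> S"
      then have "vec.subspace U" "vec.dim U = k" "S \<subseteq> U" by simp_all
      then show "U = S" using vec.subspace_dim_equal[OF less.prems(1), of U] True by simp
    next
      assume "U = S"
      then show "U \<in> ?\<C> S" using less.prems True by simp
    qed
    then have "?\<C> S = {S}" unfolding set_eq_iff singleton_iff by (rule allI)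
    with True show ?thesis by simp
  next
    case False
    then have lt: "vec.dim S < k" using le by simp
    \<comment> \<open>Since \<open>vec.dim S < k\<close>, the sum of \<open>S\<close> and
      \<open>W\<close> has dimension below \<open>CARD('n)\<close>, which leaves room for
      \<open>v\<close>.\<close>
    then have "{x + y |x y. x \<in> S \<and> y \<in> W} \<noteq> UNIV"
      using dim_sum assms(4) by (metis add.commute nat_add_left_cancel_less less_irrefl vec_dim_card)
    then obtain v where v: "v \<notin> {x + y |x y. x \<in> S \<and> y \<in> W}" by blast
    \<comment> \<open>Every complement \<open>U\<close> of \<open>W\<close> meets the coset \<open>v + W\<close> in exactly one point.\<close>
    define T where "T w = vec.span (insert (v + w) S)" for w
    have notin: "v + w \<notin> S" if "w \<in> W" for w
    proof
      assume "v + w \<in> S"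
      moreover have "v = (v + w) + (- w)" by simp
      ultimately show False
        using v that assms(2) vec.subspace_neg by blast
    qed
    have dim_T: "vec.dim (T w) = Suc (vec.dim S)" if "w \<in> W" for w
      using notin[OF that] less.prems(1) unfolding T_def
      by (metis Suc_eq_plus1 vec.dim_insert vec.dim_span vec.span_eq_iff)
    have T_Int: "T w \<inter> W = {0}" if "w \<in> W" for w
    proof -
      have "y = 0" if y: "y \<in> T w" "y \<in> W" for y
      proof -
        from y obtain c where c: "y - c *s (v + w) \<in> S"
          using less.prems(1) by (auto simp: T_def vec.span_insert) (metis vec.span_eq_iff)
        \<comment> \<open>If \<open>c\<close> were nonzero, dividing by it would write
          \<open>v\<close> as a sum of elements of \<open>S\<close> and \<open>W\<close>.\<close>
        have "c = 0"
        proof (rule ccontr)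
          assume "c \<noteq> 0"
          then have "v = - inverse c *s (y - c *s (v + w)) + (inverse c *s y - w)"
            by (simp add: algebra_simps vec.scale_right_diff_distrib vec.scale_right_distrib)
          moreover have "- inverse c *s (y - c *s (v + w)) \<in> S"
            using c less.prems(1) vec.subspace_scale by blast
          moreover have "inverse c *s y - w \<in> W"
            using y \<open>w \<in> W\<close> assms(2) by (simp add: vec.subspace_diff vec.subspace_scale)
          ultimately show False using v by blast
        qed
        with c y less.prems(2) show "y = 0" by auto
      qed
      moreover have "0 \<in> T w" "0 \<in> W"
        using assms(2) by (auto simp: T_def vec.span_zero vec.subspace_0)
      ultimately show ?thesis by auto
    qed
    have T_subset: "T w \<subseteq> U \<longleftrightarrow> S \<subseteq> U \<and> v + w \<in> U" if "vec.subspace U" for U w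
      unfolding T_def using that
      by (metis insert_subset vec.span_eq_iff vec.span_minimal vec.span_superset subset_trans)
    have un: "?\<C> S = (\<Union>w\<in>W. ?\<C> (T w))"
    proof (intro equalityI subsetI)
      fix U assume "U \<in> ?\<C> S"
      then have U: "vec.subspace U" "vec.dim U = k" "S \<subseteq> U" "U \<inter> W = {0}" by auto
      \<comment> \<open>Existence of the common point: writing \<open>v = u + w\<close> gives
        \<open>u = v + (- w)\<close> in \<open>U\<close>, so the index in the union is
        \<open>- w\<close>.\<close>
      have "{x + y |x y. x \<in> U \<and> y \<in> W} = UNIV"
        using U assms(2,4) by (intro vec_sums_eq_UNIV) simp_all
      then obtain u w where uw: "u \<in> U" "w \<in> W" "v = u + w" by blast
      then have "v + (- w) \<in> U" "- w \<in> W"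
        using assms(2) by (simp_all add: vec.subspace_neg)
      then have "\<exists>w\<in>W. T w \<subseteq> U" using U(3) T_subset[OF U(1)] by blast
      then show "U \<in> (\<Union>w\<in>W. ?\<C> (T w))" using U by blast
    next
      fix U assume "U \<in> (\<Union>w\<in>W. ?\<C> (T w))"
      then show "U \<in> ?\<C> S" using T_subset by blast
    qed
    have disj: "?\<C> (T w) \<inter> ?\<C> (T w') = {}" if "w \<in> W" "w' \<in> W" "w \<noteq> w'" for w w'
    proof (rule equals0I)
      fix U assume "U \<in> ?\<C> (T w) \<inter> ?\<C> (T w')"
      then have U: "vec.subspace U" "U \<inter> W = {0}" and T: "T w \<subseteq> U" "T w' \<subseteq> U"
        by simp_all
      \<comment> \<open>Uniqueness of the common point: two of them differ by an element of
        \<open>U \<inter> W\<close>.\<close>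
      have "w - w' \<in> U"
        using T T_subset[OF U(1)] vec.subspace_diff[OF U(1), of "v + w" "v + w'"] by simp
      moreover have "w - w' \<in> W" using that assms(2) by (simp add: vec.subspace_diff)
      ultimately have "w - w' = 0" by (rule Int_eq_zeroD[OF U(2)])
      then show False using that(3) by simp
    qed
    have IH: "card (?\<C> (T w)) = CARD('a) ^ (vec.dim W * (k - Suc (vec.dim S)))" if "w \<in> W" for w
      using less.hyps[of "T w"] lt dim_T[OF that] T_Int[OF that] by (simp add: T_def)
    have "card (?\<C> S) = (\<Sum>w\<in>W. card (?\<C> (T w)))"
      unfolding un by (rule card_UN_disjoint) (use disj in auto)
    also have "\<dots> = CARD('a) ^ vec.dim W * CARD('a) ^ (vec.dim W * (k - Suc (vec.dim S)))"
      using IH card_vec_subspace[OF assms(2)] by simp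
    also have "\<dots> = CARD('a) ^ (vec.dim W * (k - vec.dim S))"
      using lt by (simp add: power_add[symmetric] Suc_diff_Suc flip: mult_Suc_right)
    finally show ?thesis .
  qed
qed

section \<open>Eigenvalues of the complement relation\<close>

text \<open>Passing from \<open>B\<close> to \<open>insert h B\<close> discards the \<open>W\<close>
  that contain some \<open>h + x\<close> with \<open>x\<close> in \<open>vec.span B\<close>. These
  form sums of the same kind with \<open>L\<close> enlarged by \<open>h + x\<close>, which is why
  the induction carries a general \<open>L\<close>. Before the discarding the sum is 0 by
  \<open>vanish\<close>, so the new sum is minus the discarded part. The exponent collects 0 + 1 +
  ... + (card B - 1).\<close>

lemma sum_avoiding_subspace:
  fixes S :: "('a::{field,finite} ^ 'n) set" and \<phi> :: "('a ^ 'n) set \<Rightarrow> 'b::comm_ring_1"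
  assumes \<G>: "\<And>W. W \<in> \<G> \<Longrightarrow> vec.subspace W"
    and S: "vec.subspace S"
    and vanish: "\<And>T. vec.subspace T \<Longrightarrow> T \<subset> S \<Longrightarrow> (\<Sum>W | W \<in> \<G> \<and> T \<subseteq> W. \<phi> W) = 0"
    and "vec.independent B" "vec.subspace L" "L \<inter> vec.span B = {0}" "L \<subseteq> S" "B \<subseteq> S"
  shows "(\<Sum>W | W \<in> \<G> \<and> L \<subseteq> W \<and> W \<inter> vec.span B = {0}. \<phi> W)
    = (- 1) ^ card B * of_nat (CARD('a) ^ (\<Sum>i<card B. i)) *
      (\<Sum>W | W \<in> \<G> \<and> vec.span (L \<union> B) \<subseteq> W. \<phi> W)"
proof -
  have "finite B" by simp
  then show ?thesis using assms(4-)
  proof (induction B arbitrary: L rule: finite_induct)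
    \<comment> \<open>Every subspace meets the span of the empty set in \<open>{0}\<close>, so the
      two index sets coincide.\<close>
    case empty
    moreover have "0 \<in> W" if "W \<in> \<G>" for W
      using \<G>[OF that] by (rule vec.subspace_0)
    moreover have "vec.span L = L"
      using empty(2) by (simp only: vec.span_eq_iff)
    ultimately have "{W. W \<in> \<G> \<and> L \<subseteq> W \<and> W \<inter> vec.span {} = {0}} =
        {W. W \<in> \<G> \<and> vec.span (L \<union> {}) \<subseteq> W}"
      by (simp only: vec.span_empty Un_empty_right) blast
    then show ?case by simp
  next
    case (insert h B)
    let ?H = "vec.span B" and ?H' = "vec.span (insert h B)"
    let ?Z = "\<lambda>L B. {W. W \<in> \<G> \<and> L \<subseteq> W \<and> W \<inter> vec.span B = {0}}"
    have h: "h \<notin> ?H" and indep: "vec.independent B"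
      using insert.prems(1) insert.hyps by (simp_all add: vec.independent_insert)
    have sub: "?H \<subseteq> ?H'" by (simp add: subset_insertI vec.span_mono)
    have hH': "h \<in> ?H'" by (simp add: vec.span_base)
    have L_Int: "L \<inter> ?H = {0}"
      using insert.prems(3) sub vec.span_zero vec.subspace_0[OF insert.prems(2)] by blast
    \<comment> \<open>A subspace meeting \<open>?H\<close> trivially meets \<open>?H'\<close> either trivially or in the line through
      \<open>h + x\<close> for a unique \<open>x \<in> ?H\<close>.\<close>
    define T where "T x = vec.span (insert (h + x) L)" for x
    have T_subset: "T x \<subseteq> U \<longleftrightarrow> L \<subseteq> U \<and> h + x \<in> U" if "vec.subspace U" for U x
      unfolding T_def using that
      by (metis insert_subset vec.span_eq_iff vec.span_minimal vec.span_superset subset_trans)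
    have hx: "h + x \<notin> ?H" if "x \<in> ?H" for x
      using h that vec.span_add_eq2 by blast
    \<comment> \<open>This is the disjointness required to apply the induction hypothesis with
      \<open>T x\<close> in place of \<open>L\<close>.\<close>
    have T_Int: "T x \<inter> ?H = {0}" if x: "x \<in> ?H" for x
    proof -
      have "y = 0" if y: "y \<in> T x" "y \<in> ?H" for y
      proof -
        from y obtain c where c: "y - c *s (h + x) \<in> L"
          using insert.prems(2) by (auto simp: T_def vec.span_insert) (metis vec.span_eq_iff)
        moreover have "y - c *s (h + x) \<in> ?H'"
          using x y(2) sub hH' by (meson subsetD vec.span_add vec.span_diff vec.span_scale)
        ultimately have "y - c *s (h + x) = 0" by (rule Int_eq_zeroD[OF insert.prems(3)])
        then have y_eq: "y = c *s (h + x)" by (simp only: right_minus_eq)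
        then have "c = 0"
          using y(2) hx[OF x] vec_span_scaleD by blast
        with y_eq show "y = 0" by simp
      qed
      moreover have "0 \<in> T x" by (simp add: T_def vec.span_zero)
      ultimately show ?thesis using vec.span_zero by blast
    qed
    \<comment> \<open>Modulo \<open>vec.span B\<close> the vectors \<open>h\<close> and
      \<open>h + x\<close> agree, so the span does not depend on \<open>x\<close> and all discarded
      parts have equal sums.\<close>
    have span_T: "vec.span (T x \<union> B) = vec.span (L \<union> insert h B)" if x: "x \<in> ?H" for x
    proof (rule vec.span_eq[THEN iffD2], intro conjI)
      have "L \<union> insert h B \<subseteq> vec.span (L \<union> insert h B)" by (rule vec.span_superset)
      moreover have "x \<in> vec.span (L \<union> insert h B)"
        using x vec.span_mono[of B "L \<union> insert h B"] by blast
      ultimately have "h + x \<in> vec.span (L \<union> insert h B)" "L \<subseteq> vec.span (L \<union> insert h B)"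
        by (auto intro: vec.span_add)
      then show "T x \<union> B \<subseteq> vec.span (L \<union> insert h B)"
        using \<open>L \<union> insert h B \<subseteq> _\<close> T_subset by auto
    next
      have "T x \<union> B \<subseteq> vec.span (T x \<union> B)" by (rule vec.span_superset)
      moreover have "x \<in> vec.span (T x \<union> B)"
        using x vec.span_mono[of B "T x \<union> B"] by blast
      moreover have "h + x \<in> T x" "L \<subseteq> T x"
        by (auto simp: T_def intro: vec.span_base)
      ultimately show "L \<union> insert h B \<subseteq> vec.span (T x \<union> B)"
        using vec.span_diff[of "h + x" "T x \<union> B" x] by auto
    qed
    have "?Z L B = ?Z L (insert h B) \<union> (\<Union>x\<in>?H. ?Z (T x) B)"
    proof (intro equalityI subsetI)
      fix W assume "W \<in> ?Z L B"
      then have W: "W \<in> \<G>" "L \<subseteq> W" "W \<inter> ?H = {0}" by auto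
      show "W \<in> ?Z L (insert h B) \<union> (\<Union>x\<in>?H. ?Z (T x) B)"
      proof (cases "W \<inter> ?H' = {0}")
        case True
        with W show ?thesis by blast
      next
        case False
        moreover have "0 \<in> W \<inter> ?H'"
          using \<G>[OF W(1)] by (simp add: vec.subspace_0 vec.span_zero)
        ultimately obtain y where y: "y \<in> W" "y \<in> ?H'" "y \<noteq> 0" by blast
        then obtain c where c: "y - c *s h \<in> ?H" by (auto simp: vec.span_insert)
        have "c \<noteq> 0"
        proof
          assume "c = 0"
          with c have "y \<in> ?H" by simp
          then show False using y Int_eq_zeroD[OF W(3)] by blast
        qed
        \<comment> \<open>Rescaling \<open>y\<close> brings its coefficient at \<open>h\<close> to
          1, so that it takes the form \<open>h + x\<close>.\<close>
        then have "h + inverse c *s (y - c *s h) = inverse c *s y"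
          by (simp add: algebra_simps vec.scale_right_diff_distrib)
        then have "h + inverse c *s (y - c *s h) \<in> W"
          using y(1) \<G>[OF W(1)] by (simp add: vec.subspace_scale)
        moreover have "inverse c *s (y - c *s h) \<in> ?H" using c by (rule vec.span_scale)
        ultimately have "\<exists>x\<in>?H. T x \<subseteq> W" using W(2) T_subset[OF \<G>[OF W(1)]] by blast
        with W show ?thesis by blast
      qed
    next
      fix W assume "W \<in> ?Z L (insert h B) \<union> (\<Union>x\<in>?H. ?Z (T x) B)"
      then show "W \<in> ?Z L B"
      proof
        assume W: "W \<in> ?Z L (insert h B)"
        then have "0 \<in> W" using \<G> vec.subspace_0 by blast
        then show ?thesis using W sub vec.span_zero[of B] by auto
      next
        assume "W \<in> (\<Union>x\<in>?H. ?Z (T x) B)"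
        then show ?thesis using \<G> T_subset by blast
      qed
    qed
    moreover have "?Z L (insert h B) \<inter> (\<Union>x\<in>?H. ?Z (T x) B) = {}"
    proof (rule equals0I)
      fix W assume "W \<in> ?Z L (insert h B) \<inter> (\<Union>x\<in>?H. ?Z (T x) B)"
      then have W: "W \<in> \<G>" "W \<inter> ?H' = {0}" and "\<exists>x\<in>?H. T x \<subseteq> W" by simp_all
      then obtain x where x: "x \<in> ?H" "T x \<subseteq> W" by blast
      then have hxW: "h + x \<in> W" using T_subset[OF \<G>[OF W(1)]] by blast
      have "h + x \<in> ?H'" using x(1) sub hH' vec.span_add by blast
      then have "h + x = 0" by (rule Int_eq_zeroD[OF W(2) hxW])
      then show False using hx[OF x(1)] vec.span_zero by metis
    qed
    ultimately have "sum \<phi> (?Z L B) = sum \<phi> (?Z L (insert h B)) + sum \<phi> (\<Union>x\<in>?H. ?Z (T x) B)"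
      by (simp add: sum.union_disjoint)
    also have "sum \<phi> (\<Union>x\<in>?H. ?Z (T x) B) = (\<Sum>x\<in>?H. sum \<phi> (?Z (T x) B))"
    proof (rule sum.UNION_disjoint, simp, simp, intro ballI impI)
      fix x x' assume x: "x \<in> ?H" "x' \<in> ?H" "x \<noteq> x'"
      show "?Z (T x) B \<inter> ?Z (T x') B = {}"
      proof (rule equals0I)
        fix W assume "W \<in> ?Z (T x) B \<inter> ?Z (T x') B"
        then have W: "W \<in> \<G>" "W \<inter> ?H = {0}" and T: "T x \<subseteq> W" "T x' \<subseteq> W" by simp_all
        have "x - x' \<in> W"
          using T T_subset[OF \<G>[OF W(1)]] vec.subspace_diff[OF \<G>[OF W(1)], of "h + x" "h + x'"]
          by simp
        moreover have "x - x' \<in> ?H" using x by (simp add: vec.span_diff)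
        ultimately have "x - x' = 0" by (rule Int_eq_zeroD[OF W(2)])
        then show False using x(3) by simp
      qed
    qed
    \<comment> \<open>By the induction hypothesis this is a multiple of the sum over the
      \<open>W\<close> containing \<open>vec.span (L \<union> B)\<close>. That span misses
      \<open>h\<close>, hence is a proper subspace of \<open>S\<close>, and \<open>vanish\<close>
      applies.\<close>
    also have "sum \<phi> (?Z L B) = 0"
    proof -
      have "vec.span (L \<union> B) \<subseteq> S" using insert.prems(4,5) S by (intro vec.span_minimal) auto
      moreover have "h \<notin> vec.span (L \<union> B)"
      proof
        assume "h \<in> vec.span (L \<union> B)"
        moreover have "vec.span L = L" using insert.prems(2) by (simp add: vec.span_eq_iff)
        ultimately obtain l b where lb: "l \<in> L" "b \<in> ?H" "h = l + b"
          by (auto simp: vec.span_Un)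
        then have "l = h - b" by simp
        then have "l \<in> ?H'" using lb(2) sub hH' vec.span_diff by blast
        then have "l = 0" using lb(1) insert.prems(3) by blast
        then show False using lb h by simp
      qed
      ultimately have "vec.span (L \<union> B) \<subset> S" using insert.prems(5) by blast
      then show ?thesis
        using insert.IH[OF indep insert.prems(2) L_Int insert.prems(4)] insert.prems(5)
          vanish[of "vec.span (L \<union> B)"] by simp
    qed
    also have "(\<Sum>x\<in>?H. sum \<phi> (?Z (T x) B)) =
        (\<Sum>x\<in>?H. (- 1) ^ card B * of_nat (CARD('a) ^ (\<Sum>i<card B. i)) *
          (\<Sum>W | W \<in> \<G> \<and> vec.span (L \<union> insert h B) \<subseteq> W. \<phi> W))"
    proof (rule sum.cong)
      fix x assume x: "x \<in> ?H"
      have "?H \<subseteq> S" using insert.prems(5) S by (intro vec.span_minimal) auto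
      then have "T x \<subseteq> S"
        using insert.prems(4,5) S x T_subset vec.subspace_add by blast
      then show "sum \<phi> (?Z (T x) B) = (- 1) ^ card B * of_nat (CARD('a) ^ (\<Sum>i<card B. i)) *
          (\<Sum>W | W \<in> \<G> \<and> vec.span (L \<union> insert h B) \<subseteq> W. \<phi> W)"
        using insert.IH[OF indep _ T_Int[OF x]] insert.prems(5) span_T[OF x] by (simp add: T_def)
    qed simp
    \<comment> \<open>The number of \<open>x\<close> supplies the next term \<open>card B\<close> of
      the exponent; solving the equation for the sum over \<open>?Z L (insert h B)\<close> then
      supplies the sign.\<close>
    also have "\<dots> = of_nat (CARD('a) ^ card B) *
        ((- 1) ^ card B * of_nat (CARD('a) ^ (\<Sum>i<card B. i)) *
          (\<Sum>W | W \<in> \<G> \<and> vec.span (L \<union> insert h B) \<subseteq> W. \<phi> W))"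
      using card_vec_span[OF indep] by simp
    finally show ?case
      using insert.hyps
      by (simp add: power_add algebra_simps eq_neg_iff_add_eq_0)
  qed
qed

text \<open>With \<open>d\<close> the dimension of the minimal \<open>S\<close> and
  \<open>q = CARD('a)\<close>, the eigenvalue found is \<open>(- 1) ^ d\<close> times
  \<open>q\<close> to the power k (k - d) + d (d - 1) / 2.\<close>

lemma complement_sum_eigenvalue:
  fixes \<phi> :: "('a::{field,finite} ^ 'n) set \<Rightarrow> 'b::{idom,ring_char_0}"
  assumes n: "CARD('n) = 2 * k"
    and eig: "\<And>W. vec.subspace W \<Longrightarrow> vec.dim W = k \<Longrightarrow>
      (\<Sum>U | vec.subspace U \<and> vec.dim U = k \<and> U \<inter> W = {0}. \<phi> U) = e * \<phi> W"
    and W0: "vec.subspace W0" "vec.dim W0 = k" "\<phi> W0 \<noteq> 0"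
  shows "\<exists>j s. e = (- 1) ^ j * of_nat (CARD('a) ^ s)"
proof -
  define \<G> where "\<G> = {W :: ('a ^ 'n) set. vec.subspace W \<and> vec.dim W = k}"
  define F where "F T = (\<Sum>W | W \<in> \<G> \<and> T \<subseteq> W. \<phi> W)" for T
  \<comment> \<open>Only \<open>W0\<close> itself contributes to \<open>F W0\<close>, so
    \<open>F\<close> is nonzero somewhere and a minimal \<open>S\<close> exists.\<close>
  have "W \<in> \<G> \<and> W0 \<subseteq> W \<longleftrightarrow> W = W0" for W
  proof
    assume "W \<in> \<G> \<and> W0 \<subseteq> W"
    then show "W = W0"
      using W0(2) vec.subspace_dim_equal[OF W0(1), of W] by (simp add: \<G>_def)
  qed (use W0 in \<open>simp add: \<G>_def\<close>)
  then have "F W0 = \<phi> W0" by (simp add: F_def)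
  \<comment> \<open>Minimality is taken with respect to cardinality; everything is finite, so proper
    subspaces of \<open>S\<close> are strictly smaller.\<close>
  then obtain S where S: "vec.subspace S" "F S \<noteq> 0"
    and min: "\<And>T. vec.subspace T \<Longrightarrow> F T \<noteq> 0 \<Longrightarrow> card S \<le> card T"
    using W0(1,3) ex_has_least_nat[of "\<lambda>T. vec.subspace T \<and> F T \<noteq> 0" W0 card] by auto
  have vanish: "F T = 0" if "vec.subspace T" "T \<subset> S" for T
    using min[OF that(1)] psubset_card_mono[OF _ that(2)] by force
  obtain B where B: "B \<subseteq> S" "vec.independent B" "vec.span B = S"
    using vec.basis_exists[of S] vec.span_subspace[OF _ _ S(1)] by metis
  define c where "c = CARD('a) ^ (k * (k - vec.dim S))"
  have count: "card {W. W \<in> \<G> \<and> S \<subseteq> W \<and> U \<inter> W = {0}} = (if U \<inter> S = {0} then c else 0)"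
    if "U \<in> \<G>" for U
  proof (cases "U \<inter> S = {0}")
    case True
    have "{W. W \<in> \<G> \<and> S \<subseteq> W \<and> U \<inter> W = {0}} =
        {W. vec.subspace W \<and> vec.dim W = k \<and> S \<subseteq> W \<and> W \<inter> U = {0}}"
      by (simp add: \<G>_def Int_commute conj_ac)
    then show ?thesis
      using True that card_complements_containing[OF S(1), of U k] n
      by (simp add: \<G>_def c_def Int_commute)
  next
    case False
    moreover have "0 \<in> U \<inter> S"
      using that S(1) by (simp add: \<G>_def vec.subspace_0)
    ultimately obtain x where x: "x \<in> U" "x \<in> S" "x \<noteq> 0" by blast
    have "{W. W \<in> \<G> \<and> S \<subseteq> W \<and> U \<inter> W = {0}} = {}"
    proof (rule equals0I)
      fix W assume "W \<in> {W. W \<in> \<G> \<and> S \<subseteq> W \<and> U \<inter> W = {0}}"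
      then have "S \<subseteq> W" "U \<inter> W = {0}" by simp_all
      then show False using x Int_eq_zeroD by blast
    qed
    with False show ?thesis by simp
  qed
  \<comment> \<open>The eigenvalue equation is applied at every \<open>W\<close> containing
    \<open>S\<close>; exchanging the sums leaves the count of such \<open>W\<close> complementary to
    a fixed \<open>U\<close>.\<close>
  have "e * F S = (\<Sum>W | W \<in> \<G> \<and> S \<subseteq> W. \<Sum>U | U \<in> \<G> \<and> U \<inter> W = {0}. \<phi> U)"
    unfolding F_def sum_distrib_left by (intro sum.cong) (simp_all add: \<G>_def eig conj_assoc)
  also have "\<dots> = (\<Sum>W | W \<in> \<G> \<and> S \<subseteq> W. \<Sum>U\<in>\<G>. if U \<inter> W = {0} then \<phi> U else 0)"
    by (simp add: sum.inter_filter)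
  also have "\<dots> = (\<Sum>U\<in>\<G>. \<Sum>W | W \<in> \<G> \<and> S \<subseteq> W. if U \<inter> W = {0} then \<phi> U else 0)"
    by (rule sum.swap)
  also have "\<dots> = (\<Sum>U\<in>\<G>. of_nat (card {W. W \<in> \<G> \<and> S \<subseteq> W \<and> U \<inter> W = {0}}) * \<phi> U)"
    by (simp add: sum.inter_filter[symmetric] conj_assoc)
  also have "\<dots> = (\<Sum>U\<in>\<G>. if U \<inter> S = {0} then of_nat c * \<phi> U else 0)"
    by (intro sum.cong) (simp_all add: count)
  also have "\<dots> = (\<Sum>U | U \<in> \<G> \<and> U \<inter> S = {0}. of_nat c * \<phi> U)"
    by (simp add: sum.inter_filter)
  \<comment> \<open>The condition on \<open>{0}\<close> holds for every subspace; it gives the sum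
    the form treated above with \<open>L = {0}\<close>.\<close>
  also have "{U. U \<in> \<G> \<and> U \<inter> S = {0}} = {U. U \<in> \<G> \<and> {0} \<subseteq> U \<and> U \<inter> vec.span B = {0}}"
    by (auto simp: B(3) \<G>_def vec.subspace_0)
  also have "(\<Sum>U | U \<in> \<G> \<and> {0} \<subseteq> U \<and> U \<inter> vec.span B = {0}. of_nat c * \<phi> U) =
      of_nat c * (\<Sum>U | U \<in> \<G> \<and> {0} \<subseteq> U \<and> U \<inter> vec.span B = {0}. \<phi> U)"
    by (rule sum_distrib_left[symmetric])
  also have "(\<Sum>U | U \<in> \<G> \<and> {0} \<subseteq> U \<and> U \<inter> vec.span B = {0}. \<phi> U) =
      (- 1) ^ card B * of_nat (CARD('a) ^ (\<Sum>i<card B. i)) * F (vec.span ({0} \<union> B))"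
    unfolding F_def
    by (rule sum_avoiding_subspace[where S = S])
      (use B S vanish in \<open>simp_all add: \<G>_def F_def vec.subspace_0 vec.span_zero\<close>)
  also have "vec.span ({0} \<union> B) = S" using B(3) by simp
  finally have "e = (- 1) ^ card B * of_nat (c * CARD('a) ^ (\<Sum>i<card B. i))"
    using S(2) by (simp add: mult_ac)
  then show ?thesis unfolding c_def power_add[symmetric] by blast
qed

section \<open>The graph on subspaces of half the dimension\<close>

text \<open>As \<open>0 < k < 2 * k\<close>, a subspace of dimension \<open>k\<close> is
  automatically nonzero and proper.\<close>

lemma X0_dim_UNIV_verts:
  assumes "k \<ge> 1" "CARD('n) = 2 * k"
  shows "verts (X0_dim k (UNIV :: ('a::field ^ 'n) set)) = {W. vec.subspace W \<and> vec.dim W = k}"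
proof -
  have "W \<noteq> {0} \<and> W \<noteq> UNIV" if "vec.dim W = k" for W :: "('a ^ 'n) set"
  proof
    show "W \<noteq> {0}"
    proof
      assume "W = {0}"
      then have "vec.dim W = 0" by simp
      with that assms(1) show False by simp
    qed
    show "W \<noteq> UNIV"
    proof
      assume "W = UNIV"
      then have "vec.dim W = CARD('n)" by (simp only: vec_dim_card)
      with that assms show False by simp
    qed
  qed
  then show ?thesis
    by (auto simp: X0_dim_def X0_def X0_verts_def)
qed

text \<open>The dimensions of two vertices add up to that of the whole space, so adjacency reduces
  to trivial intersection. This translates the graph eigenvalue equation into linear
  algebra.\<close>

lemma X0_dim_UNIV_sum_out_arcs:
  fixes \<phi> :: "('a::field ^ 'n) set \<Rightarrow> 'b::comm_monoid_add" and k :: nat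
  defines "X \<equiv> X0_dim k (UNIV :: ('a ^ 'n) set)"
  assumes k: "k \<ge> 1" "CARD('n) = 2 * k" and W: "W \<in> verts X"
  shows "(\<Sum>a\<in>out_arcs X W. \<phi> (head X a)) =
    (\<Sum>U | vec.subspace U \<and> vec.dim U = k \<and> U \<inter> W = {0}. \<phi> U)"
proof -
  have "is_direct_sum UNIV W U \<longleftrightarrow> U \<inter> W = {0}" if "U \<in> verts X" for U
    using that W vec_sums_eq_UNIV[of W U] k(2) unfolding X_def X0_dim_UNIV_verts[OF k]
    by (auto simp: is_direct_sum_def Int_commute)
  moreover have "out_arcs X W = Pair W ` {U. U \<in> verts X \<and> is_direct_sum UNIV W U}"
    using W by (auto simp: X_def X0_dim_def X0_def out_arcs_def)
  ultimately have "out_arcs X W = Pair W ` {U. U \<in> verts X \<and> U \<inter> W = {0}}"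
    by (simp cong: conj_cong)
  moreover have "head X = snd" by (simp add: X_def X0_dim_def X0_def)
  ultimately show ?thesis
    by (simp add: sum.reindex inj_on_def X_def X0_dim_UNIV_verts[OF k] conj_assoc)
qed


theorem theorem8p5p3:
  fixes q k :: nat and V :: "('a::{field,finite} ^ 'n) set"
  assumes "q = CARD('a)"
    and "k \<ge> 1"
    and "CARD('n) = 2 * k"
    and "V = UNIV"
  shows "\<exists>(m::nat) (\<epsilon> :: nat \<Rightarrow> rat) (s :: nat \<Rightarrow> nat).
           (\<forall>i<m. \<epsilon> i \<in> {1, -1}) \<and>
           1 / walk_zeta (X0_dim k V) =
             (\<Prod>i<m. 1 + fps_const (\<epsilon> i * of_nat q ^ s i) * fps_X)"
proof -
  define X where "X = X0_dim k V"
  interpret graph X unfolding X_def by (rule X0_dim_graph)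
  have verts: "verts X = {W. vec.subspace W \<and> vec.dim W = k}"
    unfolding X_def assms(4) by (rule X0_dim_UNIV_verts[OF assms(2,3)])
  have out: "(\<Sum>a\<in>out_arcs X W. \<phi> (head X a)) =
      (\<Sum>U | vec.subspace U \<and> vec.dim U = k \<and> U \<inter> W = {0}. \<phi> U)"
    if "W \<in> verts X" for W and \<phi> :: "_ \<Rightarrow> complex"
    using that unfolding X_def assms(4) by (rule X0_dim_UNIV_sum_out_arcs[OF assms(2,3)])
  obtain es :: "complex list"
    where eig: "\<And>e. e \<in> set es \<Longrightarrow> \<exists>\<phi>. (\<exists>v\<in>verts X. \<phi> v \<noteq> 0) \<and>
        (\<forall>v\<in>verts X. (\<Sum>a\<in>out_arcs X v. \<phi> (head X a)) = e * \<phi> v)"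
      and es: "\<And>l. of_nat (num_closed_walks X l) = (\<Sum>e\<leftarrow>es. e ^ l)"
    using num_closed_walks_eq_sum_eigenvalues by blast
  define m where "m = length es"
  have "\<exists>\<epsilon> s. \<epsilon> \<in> {1, - 1 :: rat} \<and> es ! i = of_rat (- (\<epsilon> * of_nat q ^ s))" if "i < m" for i
  proof -
    have "es ! i \<in> set es" using that by (simp add: m_def)
    from eig[OF this] obtain \<phi> W0 where \<phi>: "W0 \<in> verts X" "\<phi> W0 \<noteq> 0"
      "\<And>W. W \<in> verts X \<Longrightarrow> (\<Sum>a\<in>out_arcs X W. \<phi> (head X a)) = es ! i * \<phi> W"
      by blast
    have "\<exists>j s. es ! i = (- 1) ^ j * of_nat (CARD('a) ^ s)"
      by (rule complement_sum_eigenvalue[OF assms(3), of \<phi>])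
        (use \<phi> out in \<open>auto simp: verts\<close>)
    then obtain j s where "es ! i = (- 1) ^ j * of_nat (q ^ s)"
      unfolding assms(1) by blast
    \<comment> \<open>The factor for an eigenvalue \<open>e\<close> is \<open>1 - e X\<close>, so
      the sign in the claimed form is the negative of \<open>(- 1) ^ j\<close>.\<close>
    then have "es ! i = of_rat (- (- ((- 1) ^ j) * of_nat q ^ s))"
      by (simp add: of_rat_mult of_rat_power of_rat_minus)
    moreover have "- ((- 1) ^ j) \<in> {1, - 1 :: rat}" by (cases "even j") simp_all
    ultimately show ?thesis by blast
  qed
  then obtain \<epsilon> s where \<epsilon>: "\<And>i. i < m \<Longrightarrow> \<epsilon> i \<in> {1, - 1 :: rat}"
    and nth: "\<And>i. i < m \<Longrightarrow> es ! i = of_rat (- (\<epsilon> i * of_nat q ^ s i))"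
    by metis
  \<comment> \<open>The eigenvalues were found over the complex numbers while the zeta function has
    rational coefficients; \<open>ls\<close> is their list as rationals, and injectivity of
    \<open>of_rat\<close> carries the power sum identity over.\<close>
  define ls where "ls = map (\<lambda>i. - (\<epsilon> i * of_nat q ^ s i)) [0..<m]"
  have es_ls: "es = map of_rat ls"
    by (rule nth_equalityI) (simp_all add: ls_def m_def[symmetric] nth)
  have "of_nat (num_closed_walks X l) = (\<Sum>e\<leftarrow>ls. e ^ l)" for l
  proof -
    have "(of_rat (of_nat (num_closed_walks X l)) :: complex) = (\<Sum>e\<leftarrow>ls. of_rat e ^ l)"
      using es[of l] by (simp add: es_ls comp_def)
    also have "\<dots> = of_rat (\<Sum>e\<leftarrow>ls. e ^ l)"
      by (induction ls) (simp_all add: of_rat_add of_rat_power)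
    finally show ?thesis by (simp only: of_rat_eq_iff)
  qed
  then have "1 / walk_zeta X = (\<Prod>e\<leftarrow>ls. 1 - fps_const e * fps_X)"
    by (rule inverse_walk_zeta)
  also have "\<dots> = (\<Prod>i<m. 1 + fps_const (\<epsilon> i * of_nat q ^ s i) * fps_X)"
    by (simp add: ls_def comp_def prod.distinct_set_conv_list[symmetric] atLeast0LessThan
        fps_const_neg[symmetric] del: fps_const_neg)
  finally show ?thesis using \<epsilon> unfolding X_def by blast
qed

end
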